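(* Let $N\ge4$, let $t_j=A+(j-1)\Delta$ with $\Delta=(B-A)/(N-1)$, $j=1,\dots,N$, be equidistant points on $[A,B]$, and consider the one-parameter linear regression model $y_j=\theta f(t_j)+\epsilon_j$, $j=1,\dots,N$, where the errors $\epsilon_1,\dots,\epsilon_N$ are consecutive values of a stationary discrete $\mathrm{AR}(2)$ process $$\epsilon_j-a_1\epsilon_{j-1}-a_2\epsilon_{j-2}=z_j,\qquad j\in\mathbb{Z},$$ with mean $0$ and variance $1$. Suppose $f_i=f(t_i)\neq0$ for $i=1,\dots,N$. Let $k_0=1+a_1^2+a_2^2$, $k_1=-a_1+a_1a_2$, $k_2=-a_2$, $k_{11}=1$, $k_{12}=k_{21}=-a_1$, $k_{22}=1+a_1^2$ and $S=(1+a_1-a_2)(1-a_1-a_2)(1+a_2)/(1-a_2)$. Then the optimal weights $w_i^*=\mathbf e_i^T\Sigma^{-1}\mathbf f/f_i$ are given explicitly by $$w_1^*=\frac{1}{Sf_1}\left(k_{11}f_1+k_{12}f_2+k_2f_3\right),$$ $$w_2^*=\frac{1}{Sf_2}\left(k_{21}f_1+k_{22}f_2+k_1f_3+k_2f_4\right),$$ $$w_N^*=\frac{1}{Sf_N}\left(k_{11}f_N+k_{21}f_{N-1}+k_2f_{N-2}\right),$$ $$w_{N-1}^*=\frac{1}{Sf_{N-1}}\left(k_{12}f_N+k_{22}f_{N-1}+k_1f_{N-2}+k_2f_{N-3}\right),$$ $$w_i^*=\frac{1}{Sf_i}\left(k_2f_{i-2}+k_1f_{i-1}+k_0f_i+k_1f_{i+1}+k_2f_{i+2}\right),\qquad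 i=3,\dots,N-2.$$
   Context: Here $\mathbf f=(f_1,\dots,f_N)^T$, $\mathbf e_i$ is the $i$-th unit vector of $\mathbb{R}^N$, and $\Sigma=(\mathbb{E}[\epsilon_i\epsilon_j])_{i,j=1}^N$ is the covariance matrix of the errors. The innovations $z_j$ are i.i.d. Gaussian with mean $0$ and variance $\sigma_z^2=(1+a_2)\big((1-a_2)^2-a_1^2\big)/(1-a_2)$, which makes $\mathrm{Var}(\epsilon_j)=1$ for the stationary (causal) AR(2) process. The weights $w_i^*=\mathbf e_i^T\Sigma^{-1}\mathbf f/f_i$ are called optimal because they minimize the variance $\sum_{i,j}\Sigma_{ij}w_iw_jf_if_j/(\sum_iw_if_i^2)^2$ of the signed least squares estimator. *)

theory Defs
  imports "HOL-Probability.Probability" "Jordan_Normal_Form.Gauss_Jordan_Elimination"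
begin

definition weakly_stationary :: "'s measure \<Rightarrow> (int \<Rightarrow> 's \<Rightarrow> real) \<Rightarrow> bool" where
  "weakly_stationary M X \<longleftrightarrow>
     (\<forall>j. X j \<in> borel_measurable M \<and> integrable M (\<lambda>\<omega>. (X j \<omega>)\<^sup>2)) \<and>
     (\<forall>i j. prob_space.expectation M (X i) = prob_space.expectation M (X j)) \<and>
     (\<forall>i j h. prob_space.expectation M (\<lambda>\<omega>. X (i + h) \<omega> * X (j + h) \<omega>)
            = prob_space.expectation M (\<lambda>\<omega>. X i \<omega> * X j \<omega>))"

definition iid_gaussian :: "'s measure \<Rightarrow> (int \<Rightarrow> 's \<Rightarrow> real) \<Rightarrow> real \<Rightarrow> bool" where
  "iid_gaussian M Z \<sigma> \<longleftrightarrow>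
     prob_space.indep_vars M (\<lambda>_. borel) Z UNIV \<and>
     (\<forall>j. distributed M lborel (Z j) (normal_density 0 \<sigma>))"

(* Causality in the usual time-series sense: X is an absolutely summable
   one-sided moving average of the present and past innovations. *)
definition causal :: "'s measure \<Rightarrow> (int \<Rightarrow> 's \<Rightarrow> real) \<Rightarrow> (int \<Rightarrow> 's \<Rightarrow> real) \<Rightarrow> bool" where
  "causal M X Z \<longleftrightarrow>
     (\<exists>\<psi> :: nat \<Rightarrow> real. summable (\<lambda>k. \<bar>\<psi> k\<bar>) \<and>
        (\<forall>j. AE \<omega> in M. (\<lambda>k. \<psi> k * Z (j - int k) \<omega>) sums X j \<omega>))"

definition stationary_AR2 ::
    "'s measure \<Rightarrow> real \<Rightarrow> real \<Rightarrow> (int \<Rightarrow> 's \<Rightarrow> real) \<Rightarrow> (int \<Rightarrow> 's \<Rightarrow> real) \<Rightarrow> bool" where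
  "stationary_AR2 M a1 a2 X Z \<longleftrightarrow>
     weakly_stationary M X \<and> causal M X Z \<and>
     (\<forall>j. AE \<omega> in M. X j \<omega> - a1 * X (j - 1) \<omega> - a2 * X (j - 2) \<omega> = Z j \<omega>)"

(* Matrix entries are indexed from 0, the observations from 1. *)
definition error_cov :: "'s measure \<Rightarrow> (int \<Rightarrow> 's \<Rightarrow> real) \<Rightarrow> nat \<Rightarrow> real Matrix.mat" where
  "error_cov M X N = Matrix.mat N N
     (\<lambda>(i, j). prob_space.expectation M (\<lambda>\<omega>. X (int (i + 1)) \<omega> * X (int (j + 1)) \<omega>))"

(* F and i are indexed from 1.  The result is meaningful only for invertible \<Sigma>. *)
definition optimal_weight :: "real Matrix.mat \<Rightarrow> nat \<Rightarrow> (nat \<Rightarrow> real) \<Rightarrow> nat \<Rightarrow> real" where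
  "optimal_weight \<Sigma> N F i =
     scalar_prod (unit_vec N (i - 1))
       (the (mat_inverse \<Sigma>) *\<^sub>v Matrix.vec N (\<lambda>k. F (k + 1))) / F i"

end

theory Submission
  imports Defs "Jordan_Normal_Form.Determinant"
begin

text \<open>
  By causality the innovation \<open>z j\<close> is orthogonal to the past of the process, so the autocovariance
  \<open>\<gamma>\<close> is an even function with \<open>\<phi> h = \<gamma> h - a1 \<gamma> (h - 1) - a2 \<gamma> (h - 2) = 0\<close> for \<open>h > 0\<close>.
  Together with \<open>\<gamma> 0 = 1\<close> this forces \<open>\<phi> 0 = S\<close>.  Every entry of the product of the claimed
  pentadiagonal matrix with \<open>\<Sigma>\<close> is a combination of shifts of \<open>\<phi>\<close>, which vanishes off
  the diagonal and equals \<open>S\<close> on it.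
\<close>

section \<open>Orthogonality of the innovations to the past, and the Yule-Walker equations\<close>

text \<open>\<open>causal\<close> gives only almost sure convergence of the series, so taking
  expectations term by term has to be justified. A bound \<open>C\<close> on the L1 norms that is
  uniform in \<open>k\<close>, combined with absolutely summable coefficients, makes the series of
  L1 norms converge.\<close>

lemma integral_mult_sums_eq_0:
  fixes Y :: "nat \<Rightarrow> 'a \<Rightarrow> real"
  assumes X[measurable]: "X \<in> borel_measurable M"
    and W[measurable]: "W \<in> borel_measurable M"
    and Y[measurable]: "\<And>k. Y k \<in> borel_measurable M"
    and int: "\<And>k. integrable M (\<lambda>\<omega>. W \<omega> * Y k \<omega>)"
    and orth: "\<And>k. (\<integral>\<omega>. W \<omega> * Y k \<omega> \<partial>M) = 0"
    and bound: "\<And>k. (\<integral>\<omega>. \<bar>W \<omega> * Y k \<omega>\<bar> \<partial>M) \<le> C"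
    and summ: "summable (\<lambda>k. \<bar>\<psi> k\<bar>)"
    and sums: "AE \<omega> in M. (\<lambda>k. \<psi> k * Y k \<omega>) sums X \<omega>"
  shows "(\<integral>\<omega>. W \<omega> * X \<omega> \<partial>M) = 0"
proof -
  let ?f = "\<lambda>k \<omega>. \<psi> k * (W \<omega> * Y k \<omega>)"
  have f_int: "integrable M (?f k)" for k
    using int by simp
  have norm_eq: "(\<integral>\<omega>. norm (?f k \<omega>) \<partial>M) = \<bar>\<psi> k\<bar> * (\<integral>\<omega>. \<bar>W \<omega> * Y k \<omega>\<bar> \<partial>M)" for k
    by (simp add: abs_mult mult.assoc)
  have norm_summable: "summable (\<lambda>k. \<integral>\<omega>. norm (?f k \<omega>) \<partial>M)"
  proof (rule summable_comparison_test')
    show "summable (\<lambda>k. \<bar>\<psi> k\<bar> * C)"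
      using summ by (rule summable_mult2)
    show "norm (\<integral>\<omega>. norm (?f k \<omega>) \<partial>M) \<le> \<bar>\<psi> k\<bar> * C" for k
      unfolding norm_eq using bound[of k] by (simp add: abs_mult mult_left_mono)
  qed
  \<comment> \<open>Monotone convergence: the sum of the absolute values has finite integral, hence
    is finite almost everywhere. This is the pointwise summability that
    \<open>integral_suminf\<close> requires.\<close>
  have "(\<integral>\<^sup>+\<omega>. (\<Sum>k. ennreal (norm (?f k \<omega>))) \<partial>M) = (\<Sum>k. \<integral>\<^sup>+\<omega>. ennreal (norm (?f k \<omega>)) \<partial>M)"
    by (rule nn_integral_suminf) measurable
  also have "\<dots> = (\<Sum>k. ennreal (\<integral>\<omega>. norm (?f k \<omega>) \<partial>M))"
    by (intro arg_cong[where f = suminf] ext nn_integral_eq_integral integrable_norm f_int) auto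
  also have "\<dots> \<noteq> \<infinity>"
    unfolding infinity_ennreal_def by (rule ennreal_suminf_neq_top[OF norm_summable]) simp
  finally have "AE \<omega> in M. (\<Sum>k. ennreal (norm (?f k \<omega>))) \<noteq> \<infinity>"
    by (intro nn_integral_PInf_AE) measurable
  then have ae_summable: "AE \<omega> in M. summable (\<lambda>k. norm (?f k \<omega>))"
    unfolding infinity_ennreal_def
    by eventually_elim (rule summable_suminf_not_top[OF norm_ge_zero])
  have "(\<integral>\<omega>. W \<omega> * X \<omega> \<partial>M) = (\<integral>\<omega>. (\<Sum>k. ?f k \<omega>) \<partial>M)"
  proof (rule integral_cong_AE)
    show "AE \<omega> in M. W \<omega> * X \<omega> = (\<Sum>k. ?f k \<omega>)"
      using sums
    proof eventually_elim
      case (elim \<omega>)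
      from sums_mult[OF elim, of "W \<omega>"] show ?case
        by (simp add: sums_iff ac_simps)
    qed
  qed measurable
  also have "\<dots> = (\<Sum>k. \<integral>\<omega>. ?f k \<omega> \<partial>M)"
    by (rule integral_suminf[OF f_int ae_summable norm_summable])
  also have "\<dots> = 0"
    using orth by simp
  finally show ?thesis .
qed

text \<open>Independence factors the expectations of products. Since the factors are identically
  distributed, the absolute moment is one constant for all pairs, which supplies the uniform bound
  for exchanging series and expectation.\<close>

lemma (in prob_space) iid_gaussian_mult:
  assumes "iid_gaussian M Z \<sigma>" "\<sigma> > 0"
  obtains C where "\<And>i j. i \<noteq> j \<Longrightarrow> integrable M (\<lambda>\<omega>. Z i \<omega> * Z j \<omega>)"
    "\<And>i j. i \<noteq> j \<Longrightarrow> expectation (\<lambda>\<omega>. Z i \<omega> * Z j \<omega>) = 0"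
    "\<And>i j. i \<noteq> j \<Longrightarrow> expectation (\<lambda>\<omega>. \<bar>Z i \<omega> * Z j \<omega>\<bar>) = C"
proof
  from assms have ind: "indep_vars (\<lambda>_. borel) Z UNIV"
    and dist: "\<And>j. distributed M lborel (Z j) (normal_density 0 \<sigma>)"
    by (auto simp: iid_gaussian_def)
  have int: "integrable M (Z j)" for j
    using distributed_integrable_var[OF dist] integrable_normal_moment_nz_1[OF \<open>\<sigma> > 0\<close>] by simp
  \<comment> \<open>The common first absolute moment of the innovations; the constant
    \<open>C\<close> of the lemma is its square.\<close>
  define c where "c = (\<integral>x. normal_density 0 \<sigma> x * \<bar>x\<bar> \<partial>lborel)"
  have abs: "expectation (\<lambda>\<omega>. \<bar>Z j \<omega>\<bar>) = c" for j
    unfolding c_def by (rule distributed_integral[OF dist, symmetric]) auto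
  fix i j :: int
  assume "i \<noteq> j"
  have ind2: "indep_vars (\<lambda>_. borel) Z {i, j}"
    by (rule indep_vars_subset[OF ind]) simp
  show "integrable M (\<lambda>\<omega>. Z i \<omega> * Z j \<omega>)"
    using indep_vars_integrable[OF _ ind2] int \<open>i \<noteq> j\<close> by simp
  show "expectation (\<lambda>\<omega>. Z i \<omega> * Z j \<omega>) = 0"
    using indep_vars_lebesgue_integral[OF _ ind2] int \<open>i \<noteq> j\<close>
      normal_distributed_expectation[OF \<open>\<sigma> > 0\<close> dist] by simp
  have "indep_vars (\<lambda>_. borel) (\<lambda>k \<omega>. \<bar>Z k \<omega>\<bar>) {i, j}"
    by (rule indep_vars_compose2[OF ind2]) simp
  from indep_vars_lebesgue_integral[OF _ this] int \<open>i \<noteq> j\<close>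
  show "expectation (\<lambda>\<omega>. \<bar>Z i \<omega> * Z j \<omega>\<bar>) = c * c"
    by (simp add: abs_mult abs)
qed

text \<open>By causality \<open>X i\<close> is a series in the innovations with indices
  \<open>i - k\<close>. All of these lie strictly before \<open>j\<close>, so each term is
  orthogonal to \<open>Z j\<close>.\<close>

lemma (in prob_space) causal_innovation_orthogonal:
  assumes Z: "iid_gaussian M Z \<sigma>" "\<sigma> > 0"
    and "causal M X Z" and X: "\<And>j. X j \<in> borel_measurable M"
    and "i < j"
  shows "expectation (\<lambda>\<omega>. Z j \<omega> * X i \<omega>) = 0"
proof -
  obtain \<psi> where \<psi>: "summable (\<lambda>k. \<bar>\<psi> k\<bar>)"
    "\<And>j. AE \<omega> in M. (\<lambda>k. \<psi> k * Z (j - int k) \<omega>) sums X j \<omega>"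
    using \<open>causal M X Z\<close> unfolding causal_def by blast
  obtain C where C: "\<And>i j. i \<noteq> j \<Longrightarrow> integrable M (\<lambda>\<omega>. Z i \<omega> * Z j \<omega>)"
    "\<And>i j. i \<noteq> j \<Longrightarrow> expectation (\<lambda>\<omega>. Z i \<omega> * Z j \<omega>) = 0"
    "\<And>i j. i \<noteq> j \<Longrightarrow> expectation (\<lambda>\<omega>. \<bar>Z i \<omega> * Z j \<omega>\<bar>) = C"
    using iid_gaussian_mult[OF Z] by blast
  have Zm: "Z k \<in> borel_measurable M" for k
    using Z(1) by (simp add: iid_gaussian_def indep_vars_def2)
  have ne: "j \<noteq> i - int k" for k
    using \<open>i < j\<close> by simp
  show ?thesis
  proof (rule integral_mult_sums_eq_0[where Y = "\<lambda>k. Z (i - int k)" and C = C and \<psi> = \<psi>])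
    show "expectation (\<lambda>\<omega>. \<bar>Z j \<omega> * Z (i - int k) \<omega>\<bar>) \<le> C" for k
      using C(3)[OF ne] by simp
  qed (fact X Zm C(1)[OF ne] C(2)[OF ne] \<psi>)+
qed

text \<open>The third claim is the Yule-Walker equation: multiply the recursion at time
  \<open>h\<close> by \<open>X 0\<close> and take expectations. The restriction \<open>h > 0\<close>
  puts \<open>X 0\<close> in the past of \<open>Z h\<close>, so that the innovation term drops
  out.\<close>

lemma (in prob_space) AR2_autocovariance:
  assumes AR: "stationary_AR2 M a1 a2 X Z"
    and Z: "iid_gaussian M Z \<sigma>" "\<sigma> > 0"
  defines "\<gamma> \<equiv> \<lambda>h. expectation (\<lambda>\<omega>. X 0 \<omega> * X h \<omega>)"
  shows "expectation (\<lambda>\<omega>. X i \<omega> * X j \<omega>) = \<gamma> (j - i)"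
    and "\<gamma> (- h) = \<gamma> h"
    and "h > 0 \<Longrightarrow> \<gamma> h = a1 * \<gamma> (h - 1) + a2 * \<gamma> (h - 2)"
proof -
  have Xm[measurable]: "\<And>j. X j \<in> borel_measurable M"
    and X2: "\<And>j. integrable M (\<lambda>\<omega>. (X j \<omega>)\<^sup>2)"
    and shift: "\<And>i j h. expectation (\<lambda>\<omega>. X (i + h) \<omega> * X (j + h) \<omega>) = expectation (\<lambda>\<omega>. X i \<omega> * X j \<omega>)"
    and causal: "causal M X Z"
    and rec: "\<And>j. AE \<omega> in M. X j \<omega> - a1 * X (j - 1) \<omega> - a2 * X (j - 2) \<omega> = Z j \<omega>"
    using AR unfolding stationary_AR2_def weakly_stationary_def by auto
  have [measurable]: "Z k \<in> borel_measurable M" for k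
    using Z(1) by (simp add: iid_gaussian_def indep_vars_def2)
  show \<gamma>: "expectation (\<lambda>\<omega>. X i \<omega> * X j \<omega>) = \<gamma> (j - i)" for i j
    using shift[of 0 i "j - i"] by (simp add: \<gamma>_def)
  show "\<gamma> (- h) = \<gamma> h"
    using \<gamma>[of h 0] by (simp add: \<gamma>_def mult.commute)
  \<comment> \<open>Square integrability dominates the mixed products; their integrability is what
    allows splitting the expectation of the recursion below.\<close>
  have int: "integrable M (\<lambda>\<omega>. X i \<omega> * X j \<omega>)" for i j
  proof (rule Bochner_Integration.integrable_bound[OF Bochner_Integration.integrable_add[OF X2[of i] X2[of j]]])
    have "\<bar>a * b\<bar> \<le> a\<^sup>2 + b\<^sup>2" for a b :: real
      using sum_squares_bound[of a b] sum_squares_bound[of a "- b"] sum_power2_ge_zero[of a b]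
      by (simp add: abs_le_iff)
    then show "AE \<omega> in M. norm (X i \<omega> * X j \<omega>) \<le> norm ((X i \<omega>)\<^sup>2 + (X j \<omega>)\<^sup>2)"
      by simp
  qed measurable
  assume "h > 0"
  have "0 = expectation (\<lambda>\<omega>. Z h \<omega> * X 0 \<omega>)"
    using causal_innovation_orthogonal[OF Z causal Xm \<open>h > 0\<close>] by simp
  also have "\<dots> = expectation (\<lambda>\<omega>. X 0 \<omega> * X h \<omega> - a1 * (X 0 \<omega> * X (h - 1) \<omega>) - a2 * (X 0 \<omega> * X (h - 2) \<omega>))"
  proof (rule integral_cong_AE)
    show "AE \<omega> in M. Z h \<omega> * X 0 \<omega>
        = X 0 \<omega> * X h \<omega> - a1 * (X 0 \<omega> * X (h - 1) \<omega>) - a2 * (X 0 \<omega> * X (h - 2) \<omega>)"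
      using rec[of h] by eventually_elim (simp add: algebra_simps)
  qed measurable
  also have "\<dots> = \<gamma> h - a1 * \<gamma> (h - 1) - a2 * \<gamma> (h - 2)"
    using int by (simp add: \<gamma>_def)
  finally show "\<gamma> h = a1 * \<gamma> (h - 1) + a2 * \<gamma> (h - 2)"
    by simp
qed

section \<open>The pentadiagonal precision matrix and its product with the autocovariances\<close>

text \<open>The inverse covariance matrix of \<open>N\<close> consecutive values, scaled by the innovation variance.\<close>

definition ar2_precision :: "nat \<Rightarrow> real \<Rightarrow> real \<Rightarrow> real Matrix.mat" where
  "ar2_precision N a1 a2 = Matrix.mat N N (\<lambda>(i, j).
     if i = j then
       (if i = 0 \<or> i = N - 1 then 1 else if i = 1 \<or> i = N - 2 then 1 + a1\<^sup>2 else 1 + a1\<^sup>2 + a2\<^sup>2)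
     else if i = j + 1 \<or> j = i + 1 then
       (if i + j = 1 \<or> i + j = 2 * N - 3 then - a1 else - a1 + a1 * a2)
     else if i = j + 2 \<or> j = i + 2 then - a2
     else 0)"

lemma ar2_precision_carrier: "ar2_precision N a1 a2 \<in> carrier_mat N N"
  by (simp add: ar2_precision_def)

text \<open>Stated for an arbitrary \<open>g\<close> because it serves twice: with autocovariances
  to verify the inverse, and with the regression values to read off the weights. The bound on
  \<open>N\<close> keeps the four boundary rows distinct.\<close>

lemma ar2_precision_row:
  fixes g :: "nat \<Rightarrow> real" and a1 a2 :: real
  assumes "N \<ge> 4"
  defines "R \<equiv> \<lambda>i. \<Sum>k<N. ar2_precision N a1 a2 $$ (i, k) * g k"
  shows "R 0 = g 0 - a1 * g 1 - a2 * g 2"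
    and "R 1 = - a1 * g 0 + (1 + a1\<^sup>2) * g 1 + (- a1 + a1 * a2) * g 2 - a2 * g 3"
    and "2 \<le> i \<Longrightarrow> i + 2 < N \<Longrightarrow> R i = - a2 * g (i - 2) + (- a1 + a1 * a2) * g (i - 1)
      + (1 + a1\<^sup>2 + a2\<^sup>2) * g i + (- a1 + a1 * a2) * g (i + 1) - a2 * g (i + 2)"
    and "R (N - 2) = - a2 * g (N - 4) + (- a1 + a1 * a2) * g (N - 3) + (1 + a1\<^sup>2) * g (N - 2) - a1 * g (N - 1)"
    and "R (N - 1) = - a2 * g (N - 3) - a1 * g (N - 2) + g (N - 1)"
proof -
  \<comment> \<open>Writing \<open>N\<close> as a sum removes truncated subtraction, so that the
    simplifier can decide the index conditions in the matrix entries. The interior row below is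
    treated likewise with \<open>l\<close> and \<open>d\<close>.\<close>
  define m where "m = N - 4"
  have N: "N = m + 4"
    using \<open>N \<ge> 4\<close> by (simp add: m_def)
  have N_diff: "N - 1 = m + 3" "N - 2 = m + 2" "N - 3 = m + 1" "N - 4 = m"
    by (simp_all add: N)
  have zero: "ar2_precision N a1 a2 $$ (i, k) = 0" if "i < N" "k < N" "k + 2 < i \<or> i + 2 < k" for i k
  proof -
    have "i \<noteq> k" "i \<noteq> k + 1" "k \<noteq> i + 1" "i \<noteq> k + 2" "k \<noteq> i + 2"
      using that(3) by auto
    then show ?thesis
      using that(1,2) by (simp add: ar2_precision_def)
  qed
  have R: "R i = (\<Sum>k\<in>I. ar2_precision N a1 a2 $$ (i, k) * g k)"
    if "i < N" "I \<subseteq> {..<N}" "\<And>k. k < N \<Longrightarrow> k \<notin> I \<Longrightarrow> k + 2 < i \<or> i + 2 < k" for i I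
    unfolding R_def
  proof (intro sum.mono_neutral_right ballI)
    fix k
    assume "k \<in> {..<N} - I"
    then show "ar2_precision N a1 a2 $$ (i, k) * g k = 0"
      using zero[OF \<open>i < N\<close>, of k] that(3)[of k] by simp
  qed (use that(2) in auto)
  have "R 0 = (\<Sum>k\<in>{0, 1, 2}. ar2_precision N a1 a2 $$ (0, k) * g k)"
    by (rule R) (auto simp: N)
  then show "R 0 = g 0 - a1 * g 1 - a2 * g 2"
    by (simp add: N ar2_precision_def)
  have "R 1 = (\<Sum>k\<in>{0, 1, 2, 3}. ar2_precision N a1 a2 $$ (1, k) * g k)"
    by (rule R) (auto simp: N)
  then show "R 1 = - a1 * g 0 + (1 + a1\<^sup>2) * g 1 + (- a1 + a1 * a2) * g 2 - a2 * g 3"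
    by (simp add: N ar2_precision_def)
  show "R i = - a2 * g (i - 2) + (- a1 + a1 * a2) * g (i - 1)
      + (1 + a1\<^sup>2 + a2\<^sup>2) * g i + (- a1 + a1 * a2) * g (i + 1) - a2 * g (i + 2)"
    if "2 \<le> i" "i + 2 < N"
  proof -
    define l where "l = i - 2"
    have l: "i = l + 2"
      using \<open>2 \<le> i\<close> by (simp add: l_def)
    define d where "d = N - (l + 5)"
    have d: "N = l + d + 5"
      using \<open>i + 2 < N\<close> by (simp add: d_def l)
    have i_diff: "i - 2 = l" "i - 1 = l + 1" "i + 1 = l + 3" "i + 2 = l + 4"
      by (simp_all add: l)
    have "R i = (\<Sum>k\<in>{l, l + 1, l + 2, l + 3, l + 4}. ar2_precision N a1 a2 $$ (i, k) * g k)"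
      by (rule R) (use that in \<open>auto simp: l\<close>)
    then show ?thesis
      unfolding i_diff by (simp add: l d ar2_precision_def)
  qed
  have "R (m + 2) = (\<Sum>k\<in>{m, m + 1, m + 2, m + 3}. ar2_precision N a1 a2 $$ (m + 2, k) * g k)"
    by (rule R) (auto simp: N)
  then show "R (N - 2) = - a2 * g (N - 4) + (- a1 + a1 * a2) * g (N - 3) + (1 + a1\<^sup>2) * g (N - 2) - a1 * g (N - 1)"
    unfolding N_diff by (simp add: N ar2_precision_def)
  have "R (m + 3) = (\<Sum>k\<in>{m + 1, m + 2, m + 3}. ar2_precision N a1 a2 $$ (m + 3, k) * g k)"
    by (rule R) (auto simp: N)
  then show "R (N - 1) = - a2 * g (N - 3) - a1 * g (N - 2) + g (N - 1)"
    unfolding N_diff by (simp add: N ar2_precision_def)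
qed

text \<open>The interior rows are the AR filter composed with its time reversal, so their
  coefficients are symmetric. The rows next to the boundary are truncations of this product, and the
  first and last rows reduce to the filter itself, the last one read backwards.\<close>

lemma ar2_precision_mult_autocov:
  fixes \<gamma> :: "int \<Rightarrow> real"
  assumes "N \<ge> 4"
    and even: "\<And>h. \<gamma> (- h) = \<gamma> h"
    and yw: "\<And>h. h > 0 \<Longrightarrow> \<gamma> h = a1 * \<gamma> (h - 1) + a2 * \<gamma> (h - 2)"
    and "i < N" "j < N"
  shows "(\<Sum>k<N. ar2_precision N a1 a2 $$ (i, k) * \<gamma> (int j - int k))
    = (if i = j then \<gamma> 0 - a1 * \<gamma> 1 - a2 * \<gamma> 2 else 0)"
proof -
  define \<phi> where "\<phi> h = \<gamma> h - a1 * \<gamma> (h - 1) - a2 * \<gamma> (h - 2)" for h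
  have \<phi>_pos: "\<phi> h = 0" if "h > 0" for h
    using yw[OF that] by (simp add: \<phi>_def)
  have \<phi>_0: "\<phi> 0 = \<gamma> 0 - a1 * \<gamma> 1 - a2 * \<gamma> 2"
    using even[of 1] even[of 2] by (simp add: \<phi>_def)
  define \<kappa> where "\<kappa> h = - a2 * \<gamma> (h - 2) + (- a1 + a1 * a2) * \<gamma> (h - 1)
      + (1 + a1\<^sup>2 + a2\<^sup>2) * \<gamma> h + (- a1 + a1 * a2) * \<gamma> (h + 1) - a2 * \<gamma> (h + 2)" for h
  have \<kappa>_\<phi>: "\<kappa> h = \<phi> h - a1 * \<phi> (h + 1) - a2 * \<phi> (h + 2)" for h
    by (simp add: \<kappa>_def \<phi>_def algebra_simps power2_eq_square)
  \<comment> \<open>For negative \<open>h\<close> the combination defining \<kappa> involves values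
    of \<phi> that need not vanish. Symmetric coefficients and evenness of \<gamma> transfer the
    result from the nonnegative side.\<close>
  have \<kappa>_even: "\<kappa> (- h) = \<kappa> h" for h
  proof -
    have "\<gamma> (- h - 2) = \<gamma> (h + 2)" "\<gamma> (- h - 1) = \<gamma> (h + 1)"
      "\<gamma> (- h + 1) = \<gamma> (h - 1)" "\<gamma> (- h + 2) = \<gamma> (h - 2)"
      using even[of "h + 2"] even[of "h + 1"] even[of "h - 1"] even[of "h - 2"] by simp_all
    then show ?thesis
      unfolding \<kappa>_def by (simp only: even)
  qed
  have \<kappa>_pos: "\<kappa> h = (if h = 0 then \<phi> 0 else 0)" if "h \<ge> 0" for h
    using that by (simp add: \<kappa>_\<phi> \<phi>_pos)
  have \<kappa>: "\<kappa> h = (if h = 0 then \<phi> 0 else 0)" for h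
    using \<kappa>_pos[of h] \<kappa>_pos[of "- h"] \<kappa>_even[of h] by (cases "h \<ge> 0") auto
  \<comment> \<open>Row 1 of the matrix against column \<open>j\<close> gives \<eta> at
    \<open>j - 1\<close>, so arguments from -1 upwards occur. In terms of \<phi> it is \<kappa>
    without the term in \<open>\<phi> (h + 2)\<close>, which vanishes for these arguments.\<close>
  define \<eta> where "\<eta> h = - a1 * \<gamma> (h + 1) + (1 + a1\<^sup>2) * \<gamma> h + (- a1 + a1 * a2) * \<gamma> (h - 1) - a2 * \<gamma> (h - 2)" for h
  have \<eta>_\<phi>: "\<eta> h = \<phi> h - a1 * \<phi> (h + 1)" for h
    by (simp add: \<eta>_def \<phi>_def algebra_simps power2_eq_square)
  \<comment> \<open>At \<open>h = - 1\<close> the Yule-Walker equations say nothing about \<open>\<phi> h\<close>; evenness of \<open>\<kappa>\<close> is used instead.\<close>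
  have \<eta>: "\<eta> h = (if h = 0 then \<phi> 0 else 0)" if "h \<ge> - 1" for h
  proof (cases "h = - 1")
    case True
    then show ?thesis
      using \<kappa>_\<phi>[of "- 1"] \<kappa>[of "- 1"] by (simp add: \<eta>_\<phi> \<phi>_pos)
  next
    case False
    with that show ?thesis
      by (simp add: \<eta>_\<phi> \<phi>_pos)
  qed
  consider "i = 0" | "i = 1" | "2 \<le> i" "i + 2 < N" | "i = N - 2" | "i = N - 1"
    using \<open>i < N\<close> by linarith
  then show ?thesis
  proof cases
    case 1
    have "(\<Sum>k<N. ar2_precision N a1 a2 $$ (i, k) * \<gamma> (int j - int k)) = \<phi> (int j)"
      unfolding 1 ar2_precision_row(1)[OF \<open>N \<ge> 4\<close>] by (simp add: \<phi>_def)
    then show ?thesis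
      using 1 \<phi>_0 \<phi>_pos[of "int j"] by (cases "j = 0") auto
  next
    case 2
    have "(\<Sum>k<N. ar2_precision N a1 a2 $$ (i, k) * \<gamma> (int j - int k)) = \<eta> (int j - 1)"
      unfolding 2 ar2_precision_row(2)[OF \<open>N \<ge> 4\<close>] by (simp add: \<eta>_def)
    then show ?thesis
      using 2 \<phi>_0 \<eta>[of "int j - 1"] by auto
  next
    case 3
    have "(\<Sum>k<N. ar2_precision N a1 a2 $$ (i, k) * \<gamma> (int j - int k)) = \<kappa> (int j - int i)"
      unfolding ar2_precision_row(3)[OF \<open>N \<ge> 4\<close> 3] using 3 by (simp add: \<kappa>_def of_nat_diff algebra_simps)
    then show ?thesis
      using \<phi>_0 \<kappa>[of "int j - int i"] by auto
  next
    case 4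
    \<comment> \<open>The bottom rows are the top rows in reverse order; evenness of \<gamma>
      absorbs the reversal. Since \<open>j < N\<close>, the reflected argument is again at least
      -1.\<close>
    have "(\<Sum>k<N. ar2_precision N a1 a2 $$ (i, k) * \<gamma> (int j - int k)) = \<eta> (int N - 2 - int j)"
      unfolding 4 ar2_precision_row(4)[OF \<open>N \<ge> 4\<close>] using \<open>N \<ge> 4\<close>
        even[of "int N - 4 - int j"] even[of "int N - 3 - int j"] even[of "int N - 2 - int j"] even[of "int N - 1 - int j"]
      by (simp add: \<eta>_def of_nat_diff algebra_simps)
    then show ?thesis
      using 4 \<phi>_0 \<eta>[of "int N - 2 - int j"] \<open>N \<ge> 4\<close> \<open>j < N\<close> by (auto simp: of_nat_diff)
  next
    case 5
    have "(\<Sum>k<N. ar2_precision N a1 a2 $$ (i, k) * \<gamma> (int j - int k)) = \<phi> (int N - 1 - int j)"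
      unfolding 5 ar2_precision_row(5)[OF \<open>N \<ge> 4\<close>] using \<open>N \<ge> 4\<close>
        even[of "int N - 3 - int j"] even[of "int N - 2 - int j"] even[of "int N - 1 - int j"]
      by (simp add: \<phi>_def of_nat_diff algebra_simps)
    then show ?thesis
      using 5 \<phi>_0 \<phi>_pos[of "int N - 1 - int j"] \<open>N \<ge> 4\<close> \<open>j < N\<close> by (cases "j = N - 1") (auto simp: of_nat_diff)
  qed
qed

section \<open>From the inverse matrix to the explicit weights\<close>

text \<open>Over a field a one-sided inverse of a square matrix is two-sided, so \<open>A\<close> is
  a unit of the matrix ring. This excludes the result \<open>None\<close>, and uniqueness of
  inverses identifies the matrix returned.\<close>

lemma mat_inverse_eqI:
  fixes A B :: "'a :: field Matrix.mat"
  assumes A: "A \<in> carrier_mat n n" and B: "B \<in> carrier_mat n n" and BA: "B * A = 1\<^sub>m n"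
  shows "mat_inverse A = Some B"
proof -
  have AB: "A * B = 1\<^sub>m n"
    by (rule mat_mult_left_right_inverse[OF B A BA])
  have "A \<in> Units (ring_mat TYPE('a) n undefined)"
    using A B AB BA by (auto simp: Units_def ring_mat_simps)
  then obtain C where C: "mat_inverse A = Some C"
    using mat_inverse(1)[OF A] by fastforce
  with mat_inverse(2)[OF A] have AC: "A * C = 1\<^sub>m n" and Cc: "C \<in> carrier_mat n n"
    by blast+
  have "C = (B * A) * C"
    using Cc by (simp add: BA)
  also have "\<dots> = B"
    using A B Cc AC by (simp add: assoc_mult_mat[of B n n A n C n])
  finally show ?thesis
    using C by simp
qed

theorem corollary4p1:
  fixes M :: "'s measure"
    and N :: nat
    and A B \<Delta> \<theta> a1 a2 \<sigma>z k0 k1 k2 k11 k12 k21 k22 S :: real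
    and t F w :: "nat \<Rightarrow> real"
    and f :: "real \<Rightarrow> real"
    and y :: "nat \<Rightarrow> 's \<Rightarrow> real"
    and \<epsilon> z :: "int \<Rightarrow> 's \<Rightarrow> real"
    and \<Sigma> :: "real Matrix.mat"
  assumes "prob_space M"
    and "N \<ge> 4"
    and "A < B"
    and "\<Delta> = (B - A) / (real N - 1)"
    and "\<And>j. j \<in> {1..N} \<Longrightarrow> t j = A + (real j - 1) * \<Delta>"
    and "\<And>j \<omega>. j \<in> {1..N} \<Longrightarrow> \<omega> \<in> space M \<Longrightarrow> y j \<omega> = \<theta> * f (t j) + \<epsilon> (int j) \<omega>"
    and "\<sigma>z > 0"
    and "\<sigma>z\<^sup>2 = (1 + a2) * ((1 - a2)\<^sup>2 - a1\<^sup>2) / (1 - a2)"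
    and "iid_gaussian M z \<sigma>z"
    and "stationary_AR2 M a1 a2 \<epsilon> z"
    and "\<And>j. prob_space.expectation M (\<epsilon> j) = 0"
    and "\<And>j. prob_space.variance M (\<epsilon> j) = 1"
    and "\<And>i. i \<in> {1..N} \<Longrightarrow> F i = f (t i)"
    and "\<And>i. i \<in> {1..N} \<Longrightarrow> F i \<noteq> 0"
    and "k0 = 1 + a1\<^sup>2 + a2\<^sup>2"
    and "k1 = - a1 + a1 * a2"
    and "k2 = - a2"
    and "k11 = 1"
    and "k12 = - a1"
    and "k21 = - a1"
    and "k22 = 1 + a1\<^sup>2"
    and "S = (1 + a1 - a2) * (1 - a1 - a2) * (1 + a2) / (1 - a2)"
    and "\<Sigma> = error_cov M \<epsilon> N"
    and "\<And>i. i \<in> {1..N} \<Longrightarrow> w i = optimal_weight \<Sigma> N F i"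
  shows "invertible_mat \<Sigma> \<and>
    w 1 = 1 / (S * F 1) * (k11 * F 1 + k12 * F 2 + k2 * F 3) \<and>
    w 2 = 1 / (S * F 2) * (k21 * F 1 + k22 * F 2 + k1 * F 3 + k2 * F 4) \<and>
    w N = 1 / (S * F N) * (k11 * F N + k21 * F (N - 1) + k2 * F (N - 2)) \<and>
    w (N - 1) = 1 / (S * F (N - 1)) *
      (k12 * F N + k22 * F (N - 1) + k1 * F (N - 2) + k2 * F (N - 3)) \<and>
    (\<forall>i\<in>{3..N - 2}. w i = 1 / (S * F i) *
      (k2 * F (i - 2) + k1 * F (i - 1) + k0 * F i + k1 * F (i + 1) + k2 * F (i + 2)))"
proof -
  interpret prob_space M by fact
  note N4 = assms(2)
  define \<gamma> where "\<gamma> h = expectation (\<lambda>\<omega>. \<epsilon> 0 \<omega> * \<epsilon> h \<omega>)" for h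
  note AR = AR2_autocovariance[OF assms(10) assms(9) assms(7), folded \<gamma>_def]
  have \<gamma>0: "\<gamma> 0 = 1"
    using assms(12)[of 0] assms(11) by (simp add: \<gamma>_def power2_eq_square)
  have "\<sigma>z\<^sup>2 > 0"
    using assms(7) by simp
  \<comment> \<open>Division by zero yields 0, so a vanishing denominator would contradict the
    positive innovation variance.\<close>
  then have a2: "1 - a2 \<noteq> 0"
    unfolding assms(8) by auto
  have S_\<sigma>: "S = \<sigma>z\<^sup>2"
    unfolding assms(8) assms(22) by (simp add: power2_eq_square algebra_simps)
  have S0: "S \<noteq> 0"
    using S_\<sigma> \<open>\<sigma>z\<^sup>2 > 0\<close> by simp
  \<comment> \<open>At lag 1 the Yule-Walker equation contains \<open>\<gamma> (- 1)\<close>, which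
    equals \<open>\<gamma> 1\<close>; this leaves a linear equation for
    \<open>\<gamma> 1\<close>.\<close>
  have \<gamma>1: "\<gamma> 1 = a1 / (1 - a2)"
    using AR(3)[of 1] AR(2)[of 1] \<gamma>0 a2 by (simp add: field_simps)
  have \<gamma>2: "\<gamma> 2 = a1 * \<gamma> 1 + a2"
    using AR(3)[of 2] \<gamma>0 by simp
  have S_\<gamma>: "\<gamma> 0 - a1 * \<gamma> 1 - a2 * \<gamma> 2 = S"
  proof -
    \<comment> \<open>Multiplying by \<open>1 - a2\<close> clears the denominators of both
      \<open>\<gamma> 1\<close> and \<open>S\<close>, so that a polynomial identity remains.\<close>
    have "(\<gamma> 0 - a1 * \<gamma> 1 - a2 * \<gamma> 2) * (1 - a2)
        = (1 - a2\<^sup>2) * (1 - a2) - a1 * (1 + a2) * (\<gamma> 1 * (1 - a2))"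
      unfolding \<gamma>2 \<gamma>0 by (simp add: algebra_simps power2_eq_square)
    also have "\<gamma> 1 * (1 - a2) = a1"
      using \<gamma>1 a2 by simp
    also have "(1 - a2\<^sup>2) * (1 - a2) - a1 * (1 + a2) * a1 = (1 + a1 - a2) * (1 - a1 - a2) * (1 + a2)"
      by (simp add: algebra_simps power2_eq_square)
    finally show ?thesis
      unfolding assms(22) using a2 by (simp add: nonzero_eq_divide_eq)
  qed
  define K where "K = ar2_precision N a1 a2"
  define P where "P = (1 / S) \<cdot>\<^sub>m K"
  have K: "K \<in> carrier_mat N N"
    unfolding K_def by (rule ar2_precision_carrier)
  have P: "P \<in> carrier_mat N N"
    unfolding P_def using K by simp
  have \<Sigma>: "\<Sigma> \<in> carrier_mat N N"
    by (simp add: assms(23) error_cov_def)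
  have P_\<Sigma>: "P * \<Sigma> = 1\<^sub>m N"
  proof (rule eq_matI)
    fix i j
    assume "i < dim_row (1\<^sub>m N :: real Matrix.mat)" "j < dim_col (1\<^sub>m N :: real Matrix.mat)"
    then have ij: "i < N" "j < N"
      by simp_all
    have "(P * \<Sigma>) $$ (i, j) = (\<Sum>k<N. P $$ (i, k) * \<Sigma> $$ (k, j))"
      using P \<Sigma> ij by (auto simp: scalar_prod_def atLeast0LessThan intro!: sum.cong)
    \<comment> \<open>The offset by one between matrix indices and observation times cancels in the
      lag \<open>j - k\<close>.\<close>
    also have "\<dots> = (\<Sum>k<N. (1 / S) * (K $$ (i, k) * \<gamma> (int j - int k)))"
      using K ij AR(1) by (auto simp: P_def assms(23) error_cov_def intro!: sum.cong)
    also have "\<dots> = (1 / S) * (if i = j then S else 0)"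
      unfolding sum_distrib_left[symmetric] K_def
      using ar2_precision_mult_autocov[OF N4 AR(2,3) ij] S_\<gamma> by simp
    also have "\<dots> = (1\<^sub>m N) $$ (i, j)"
      using ij S0 by simp
    finally show "(P * \<Sigma>) $$ (i, j) = (1\<^sub>m N) $$ (i, j)" .
  qed (use P \<Sigma> in auto)
  have inv: "invertible_mat \<Sigma>"
    unfolding invertible_mat_def inverts_mat_def
    using P_\<Sigma> mat_mult_left_right_inverse[OF P \<Sigma> P_\<Sigma>] P \<Sigma> by auto
  \<comment> \<open>Weight \<open>i\<close> belongs to row \<open>i - 1\<close>, since matrix rows
    start at 0 while observations start at 1; for the same reason column \<open>k\<close> meets
    \<open>F (k + 1)\<close>.\<close>
  have w: "w i = 1 / (S * F i) * (\<Sum>k<N. K $$ (i - 1, k) * F (k + 1))" if "i \<in> {1..N}" for i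
  proof -
    have "w i = scalar_prod (unit_vec N (i - 1)) (P *\<^sub>v Matrix.vec N (\<lambda>k. F (k + 1))) / F i"
      using assms(24)[OF that] mat_inverse_eqI[OF \<Sigma> P P_\<Sigma>] by (simp add: optimal_weight_def)
    also have "scalar_prod (unit_vec N (i - 1)) (P *\<^sub>v Matrix.vec N (\<lambda>k. F (k + 1)))
        = Matrix.vec_index (P *\<^sub>v Matrix.vec N (\<lambda>k. F (k + 1))) (i - 1)"
      by (rule scalar_prod_left_unit) (use P that in auto)
    also have "\<dots> = (\<Sum>k<N. P $$ (i - 1, k) * F (k + 1))"
      using P that by (auto simp: scalar_prod_def atLeast0LessThan intro!: sum.cong)
    also have "(\<Sum>k<N. P $$ (i - 1, k) * F (k + 1)) = (\<Sum>k<N. (1 / S) * (K $$ (i - 1, k) * F (k + 1)))"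
      using K that by (auto simp: P_def intro!: sum.cong)
    finally show ?thesis
      unfolding sum_distrib_left[symmetric] by simp
  qed
  note row = ar2_precision_row[OF N4, where g = "\<lambda>k. F (k + 1)" and ?a1.0 = a1 and ?a2.0 = a2, folded K_def]
  note ks = assms(15-21)
  have "w 1 = 1 / (S * F 1) * (k11 * F 1 + k12 * F 2 + k2 * F 3)"
    using w[of 1] row(1) N4 unfolding ks by (simp add: numeral_eq_Suc)
  moreover have "w 2 = 1 / (S * F 2) * (k21 * F 1 + k22 * F 2 + k1 * F 3 + k2 * F 4)"
    using w[of 2] row(2) N4 unfolding ks by (simp add: numeral_eq_Suc)
  moreover have "w N = 1 / (S * F N) * (k11 * F N + k21 * F (N - 1) + k2 * F (N - 2))"
  proof -
    \<comment> \<open>The row formula yields \<open>F\<close> at truncated differences plus one;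
      these equations hold only because \<open>N\<close> is large enough.\<close>
    have diffs: "N - 3 + 1 = N - 2" "N - 2 + 1 = N - 1" "N - 1 + 1 = N"
      using N4 by auto
    show ?thesis
      using w[of N] N4 unfolding row(5) ks diffs by (simp add: algebra_simps)
  qed
  moreover have "w (N - 1) = 1 / (S * F (N - 1)) *
      (k12 * F N + k22 * F (N - 1) + k1 * F (N - 2) + k2 * F (N - 3))"
  proof -
    have diffs: "N - 4 + 1 = N - 3" "N - 3 + 1 = N - 2" "N - 2 + 1 = N - 1" "N - 1 + 1 = N" "N - 1 - 1 = N - 2"
      using N4 by auto
    show ?thesis
      using w[of "N - 1"] N4 unfolding diffs row(4) ks by (simp add: algebra_simps)
  qed
  moreover have "w i = 1 / (S * F i) *
      (k2 * F (i - 2) + k1 * F (i - 1) + k0 * F i + k1 * F (i + 1) + k2 * F (i + 2))"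
    if "i \<in> {3..N - 2}" for i
  proof -
    have "i - 1 - 2 + 1 = i - 2" "i - 1 - 1 + 1 = i - 1" "i - 1 + 1 = i" "i - 1 + 1 + 1 = i + 1"
      "i - 1 + 2 + 1 = i + 2" "2 \<le> i - 1" "i - 1 + 2 < N" "i \<in> {1..N}"
      using that by auto
    then show ?thesis
      using w[of i] row(3)[of "i - 1"] unfolding ks by simp
  qed
  ultimately show ?thesis
    using inv by blast
qed

end
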